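(* Let $n\ge 1$ and let $P_n\subset\mathbb{R}^n$ be the set of points $(\pi(1),\ldots,\pi(n))$ with $\pi$ a permutation of $\{1,\ldots,n\}$ (the vertex set of the permutohedron $\Pi_{n-1}$). If $H_1,\ldots,H_m$ are affine hyperplanes in $\mathbb{R}^n$ whose union contains all points of $P_n$ except exactly one point $v\in P_n$ (and does not contain $v$), then $m\ge \binom{n}{2}$. Moreover, this bound is sharp: there exist $\binom{n}{2}$ affine hyperplanes whose union contains all points of $P_n$ except exactly one.
   Context: An almost cover of a finite set $X$ in an affine space is a collection of affine hyperplanes which together cover all points of $X$ except one, the remaining point not lying on any of them. *)

theory Defs
  imports "HOL-Analysis.Analysis"
begin

definition affine_hyperplane :: "'a::euclidean_space set \<Rightarrow> bool" where
  "affine_hyperplane H \<longleftrightarrow> (\<exists>a b. a \<noteq> 0 \<and> H = {x. a \<bullet> x = b})"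

text \<open>
  Coordinates of \<open>real ^ 'n\<close> are indexed by an arbitrary finite type with \<open>n = CARD('n) \<ge> 1\<close>
  elements, so a permutation of \<open>{1..n}\<close> becomes a bijection from the index type onto \<open>{1..n}\<close>.
  Any identification of the index type with \<open>{1..n}\<close> yields the same set of points.
\<close>

definition permutohedron_vertices :: "(real ^ 'n) set" where
  "permutohedron_vertices =
     {(\<chi> i. real (p i)) | p. bij_betw p (UNIV :: 'n set) {1..CARD('n)}}"

definition almost_cover :: "'a::euclidean_space set set \<Rightarrow> 'a set \<Rightarrow> 'a \<Rightarrow> bool" where
  "almost_cover \<H> X v \<longleftrightarrow>
     (\<forall>H\<in>\<H>. affine_hyperplane H) \<and> v \<in> X \<and> X - {v} \<subseteq> \<Union>\<H> \<and> v \<notin> \<Union>\<H>"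

end

theory Submission
  imports Defs
begin

text \<open>
  Lower bound: the alternating sum of \<open>f\<close> over the orbit of \<open>v\<close> under coordinate permutations
  vanishes for every polynomial \<open>f\<close> of degree less than \<open>n choose 2\<close>. For a monomial it is the
  determinant of a generalised Vandermonde matrix, and in low degree two exponents agree, so that
  two rows coincide. If \<open>f\<close> is the product of affine forms defining an almost cover, the sum has
  the single nonzero term \<open>f v\<close>; hence the number of factors is at least \<open>n choose 2\<close>.

  Sharpness: the hyperplanes \<open>x\<^sub>k = j\<close> with \<open>1 \<le> j < k\<close> miss only the vertex \<open>(1, \<dots>, n)\<close>,
  because a permutation with \<open>\<pi>(k) \<ge> k\<close> for all \<open>k\<close> is the identity.
\<close>

text \<open>Induction by removing the maximum: all other elements lie below it, so it is at least
  their number, which is the term added on the left.\<close>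

lemma sum_lessThan_card_le_sum:
  fixes A :: "nat set"
  assumes "finite A"
  shows "\<Sum>{..<card A} \<le> \<Sum>A"
  using assms
proof (induction A rule: finite_linorder_max_induct)
  case (insert b A)
  have "A \<subseteq> {..<b}"
    using insert.hyps by auto
  then have "card A \<le> b"
    using card_mono[of "{..<b}" A] by simp
  moreover have "b \<notin> A"
    using insert.hyps by auto
  ultimately show ?case
    using insert by (simp add: lessThan_Suc)
qed simp

lemma sum_lessThan_eq_choose_two: "\<Sum>{..<n} = n choose 2"
  by (induction n) (simp_all add: lessThan_Suc numeral_2_eq_2)

text \<open>Used in contrapositive form: exponents of small total degree must contain a
  repetition.\<close>

lemma choose_two_le_sum_inj:
  fixes \<alpha> :: "'n::finite \<Rightarrow> nat"
  assumes "inj \<alpha>"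
  shows "CARD('n) choose 2 \<le> (\<Sum>i\<in>UNIV. \<alpha> i)"
  using sum_lessThan_card_le_sum[of "range \<alpha>"] card_image[OF assms]
  by (simp add: sum.reindex[OF assms] sum_lessThan_eq_choose_two)

lemma alternating_sum_monomial_eq_0:
  fixes y :: "'n::finite \<Rightarrow> real"
  assumes "(\<Sum>i\<in>UNIV. \<alpha> i) < CARD('n) choose 2"
  shows "(\<Sum>\<sigma> | \<sigma> permutes UNIV. of_int (sign \<sigma>) * (\<Prod>i\<in>UNIV. y (\<sigma> i) ^ \<alpha> i)) = 0"
proof -
  obtain i j where ij: "i \<noteq> j" "\<alpha> i = \<alpha> j"
    using choose_two_le_sum_inj[of \<alpha>] assms by (meson injI not_less)
  define A :: "real^'n^'n" where "A = (\<chi> i j. y j ^ \<alpha> i)"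
  have "row i A = row j A"
    using ij by (simp add: A_def row_def)
  then have "det A = 0"
    using det_identical_rows[OF ij(1)] by blast
  then show ?thesis
    by (simp add: det_def A_def)
qed

text \<open>The monomial factor makes the induction on the number of affine factors go through.\<close>

lemma alternating_sum_affine_prod_eq_0:
  fixes y :: "'n::finite \<Rightarrow> real" and a :: "'k \<Rightarrow> real^'n"
  assumes "finite K" and "card K + (\<Sum>i\<in>UNIV. \<alpha> i) < CARD('n) choose 2"
  shows "(\<Sum>\<sigma> | \<sigma> permutes UNIV. of_int (sign \<sigma>) * (\<Prod>i\<in>UNIV. y (\<sigma> i) ^ \<alpha> i) *
           (\<Prod>k\<in>K. a k \<bullet> (\<chi> i. y (\<sigma> i)) - b k)) = 0"
  using assms
proof (induction K arbitrary: \<alpha> rule: finite_induct)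
  case empty
  then show ?case
    by (simp add: alternating_sum_monomial_eq_0)
next
  case (insert k K)
  define P where "P = {\<sigma> :: 'n \<Rightarrow> 'n. \<sigma> permutes UNIV}"
  define F where "F \<sigma> = (\<Prod>k\<in>K. a k \<bullet> (\<chi> i. y (\<sigma> i)) - b k)" for \<sigma> :: "'n \<Rightarrow> 'n"
  define M where "M \<alpha> \<sigma> = of_int (sign \<sigma>) * (\<Prod>i\<in>UNIV. y (\<sigma> i) ^ \<alpha> i)"
    for \<alpha> and \<sigma> :: "'n \<Rightarrow> 'n"
  define \<beta> where "\<beta> j = \<alpha>(j := Suc (\<alpha> j))" for j
  have zero: "(\<Sum>\<sigma>\<in>P. M \<gamma> \<sigma> * F \<sigma>) = 0"
    if "card K + (\<Sum>i\<in>UNIV. \<gamma> i) < CARD('n) choose 2" for \<gamma>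
    using insert.IH[OF that] by (simp add: P_def F_def M_def)
  have shift: "M \<alpha> \<sigma> * y (\<sigma> j) = M (\<beta> j) \<sigma>" for \<sigma> j
    by (simp add: M_def \<beta>_def prod.remove[of UNIV j])
  have degree: "(\<Sum>i\<in>UNIV. \<beta> j i) = Suc (\<Sum>i\<in>UNIV. \<alpha> i)" for j
    by (simp add: \<beta>_def sum.remove[of UNIV j])
  \<comment> \<open>Expanding the affine form at \<open>k\<close>, each coordinate
    \<open>y (\<sigma> j)\<close> is absorbed into the monomial, raising its \<open>j\<close>-th
    exponent by one.\<close>
  have "M \<alpha> \<sigma> * ((a k \<bullet> (\<chi> i. y (\<sigma> i)) - b k) * F \<sigma>) =
      (\<Sum>j\<in>UNIV. a k $ j * (M (\<beta> j) \<sigma> * F \<sigma>)) - b k * (M \<alpha> \<sigma> * F \<sigma>)" for \<sigma>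
    by (simp add: inner_vec_def shift[symmetric] algebra_simps sum_distrib_left sum_distrib_right)
  then have "(\<Sum>\<sigma>\<in>P. M \<alpha> \<sigma> * ((a k \<bullet> (\<chi> i. y (\<sigma> i)) - b k) * F \<sigma>)) =
      (\<Sum>\<sigma>\<in>P. \<Sum>j\<in>UNIV. a k $ j * (M (\<beta> j) \<sigma> * F \<sigma>)) - b k * (\<Sum>\<sigma>\<in>P. M \<alpha> \<sigma> * F \<sigma>)"
    by (simp add: sum_subtractf sum_distrib_left)
  also have "(\<Sum>\<sigma>\<in>P. \<Sum>j\<in>UNIV. a k $ j * (M (\<beta> j) \<sigma> * F \<sigma>)) =
      (\<Sum>j\<in>UNIV. a k $ j * (\<Sum>\<sigma>\<in>P. M (\<beta> j) \<sigma> * F \<sigma>))"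
    by (subst sum.swap) (simp add: sum_distrib_left)
  \<comment> \<open>One affine factor has been traded for one degree, so the number of factors plus
    the degree is still below the bound.\<close>
  also have "\<dots> = 0"
    using insert by (simp add: zero degree)
  also have "(\<Sum>\<sigma>\<in>P. M \<alpha> \<sigma> * F \<sigma>) = 0"
    using insert by (simp add: zero)
  finally show ?case
    using insert.hyps by (simp add: P_def F_def M_def)
qed

lemma almost_cover_permutohedron_ge:
  fixes H :: "'k \<Rightarrow> (real^'n) set"
  assumes "finite K" and cover: "almost_cover (H ` K) permutohedron_vertices v"
  shows "CARD('n) choose 2 \<le> card K"
proof (rule ccontr)
  assume less: "\<not> ?thesis"
  obtain p where p: "bij_betw p (UNIV :: 'n set) {1..CARD('n)}" and v: "v = (\<chi> i. real (p i))"
    using cover by (auto simp: almost_cover_def permutohedron_vertices_def)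
  have "\<forall>k\<in>K. \<exists>a b. H k = {x. a \<bullet> x = b}"
    using cover unfolding almost_cover_def affine_hyperplane_def by blast
  then obtain a b where H: "\<And>k. k \<in> K \<Longrightarrow> H k = {x. a k \<bullet> x = b k}"
    by metis
  define f where "f x = (\<Prod>k\<in>K. a k \<bullet> x - b k)" for x
  define w where "w \<sigma> = (\<chi> i. real (p (\<sigma> i)))" for \<sigma> :: "'n \<Rightarrow> 'n"
  \<comment> \<open>With all exponents zero the auxiliary monomial is 1.\<close>
  have "(\<Sum>\<sigma> | \<sigma> permutes UNIV. of_int (sign \<sigma>) * f (w \<sigma>)) = 0"
    using alternating_sum_affine_prod_eq_0[of K "\<lambda>_. 0" "\<lambda>i. real (p i)" a b] assms(1) less
    by (simp add: f_def w_def)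
  \<comment> \<open>As \<open>p\<close> is injective, \<open>w \<sigma>\<close> is a vertex other
    than \<open>v\<close>, hence lies on some \<open>H k\<close>, where a factor of \<open>f\<close>
    vanishes.\<close>
  moreover have "f (w \<sigma>) = 0" if \<sigma>: "\<sigma> permutes UNIV" "\<sigma> \<noteq> id" for \<sigma>
  proof -
    have "bij_betw (p \<circ> \<sigma>) UNIV {1..CARD('n)}"
      using \<sigma> p by (blast intro: bij_betw_trans permutes_imp_bij)
    then have "w \<sigma> \<in> permutohedron_vertices"
      by (auto simp: w_def permutohedron_vertices_def o_def)
    moreover have "w \<sigma> \<noteq> v"
      using \<sigma> bij_betw_imp_inj_on[OF p] by (auto simp: w_def v vec_eq_iff fun_eq_iff inj_eq)
    ultimately obtain k where "k \<in> K" "w \<sigma> \<in> H k"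
      using cover by (auto simp: almost_cover_def)
    then show ?thesis
      using H assms(1) by (auto simp: f_def)
  qed
  then have "(\<Sum>\<sigma> | \<sigma> permutes UNIV. of_int (sign \<sigma>) * f (w \<sigma>)) =
      (\<Sum>\<sigma>\<in>{id}. of_int (sign \<sigma>) * f (w \<sigma>))"
    by (intro sum.mono_neutral_right) (auto simp: permutes_id)
  moreover have "f (w id) \<noteq> 0"
    using cover H assms(1) by (auto simp: f_def w_def v almost_cover_def)
  ultimately show False
    by simp
qed

text \<open>Both functions have the same sum over \<open>A\<close>, namely that of \<open>B\<close>,
  so a pointwise inequality between them cannot be strict anywhere.\<close>

lemma bij_betw_eq_of_le:
  fixes p q :: "'a \<Rightarrow> nat"
  assumes "finite A" "bij_betw p A B" "bij_betw q A B" "\<And>i. i \<in> A \<Longrightarrow> q i \<le> p i" "i \<in> A"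
  shows "p i = q i"
proof -
  have "(\<Sum>i\<in>A. q i) = (\<Sum>i\<in>A. p i)"
    using sum.reindex_bij_betw[OF assms(2), of id] sum.reindex_bij_betw[OF assms(3), of id] by simp
  then have "q i = p i"
    using assms by (intro sum_mono_inv[of q A p i]) auto
  then show ?thesis ..
qed

lemma permutohedron_almost_cover_exists:
  "\<exists>(\<H> :: (real^'n) set set) v. finite \<H> \<and> card \<H> = CARD('n) choose 2 \<and>
     almost_cover \<H> permutohedron_vertices v"
proof -
  \<comment> \<open>An arbitrary numbering \<open>q\<close> of the index type plays the role of the
    identity permutation.\<close>
  obtain q where q: "bij_betw q (UNIV :: 'n set) {1..CARD('n)}"
    using finite_same_card_bij[of "UNIV :: 'n set" "{1..CARD('n)}"]
    by auto
  define v :: "real^'n" where "v = (\<chi> i. real (q i))"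
  \<comment> \<open>The range stops before \<open>q i\<close>, so that no hyperplane contains
    \<open>v\<close>.\<close>
  define I where "I = (SIGMA i:UNIV. {1..<q i})"
  define h where "h = (\<lambda>(i :: 'n, j). {x :: real^'n. x $ i = real j})"
  have inj: "inj_on h I"
  proof (rule inj_onI, clarify)
    fix i i' :: 'n and j j'
    assume "(i, j) \<in> I" "(i', j') \<in> I" and eq: "h (i, j) = h (i', j')"
    then have "j \<ge> 1" "j' \<ge> 1"
      by (auto simp: I_def)
    \<comment> \<open>This point of \<open>h (i, j)\<close> has no nonzero coordinate except
      possibly the \<open>i\<close>-th, so \<open>j' \<ge> 1\<close> forces \<open>i' = i\<close>
      and then \<open>j' = j\<close>.\<close>
    have "axis i (real j) \<in> h (i', j')"
      unfolding eq[symmetric] by (simp add: h_def)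
    then show "i = i' \<and> j = j'"
      using \<open>j' \<ge> 1\<close> by (auto simp: h_def axis_def split: if_splits)
  qed
  have "card I = (\<Sum>i\<in>UNIV. q i - 1)"
    by (simp add: I_def)
  also have "\<dots> = (\<Sum>k\<in>{1..CARD('n)}. k - 1)"
    by (rule sum.reindex_bij_betw[OF q])
  also have "\<dots> = \<Sum>{..<CARD('n)}"
    by (rule sum.reindex_bij_witness[of _ Suc "\<lambda>k. k - 1"]) auto
  finally have "card I = CARD('n) choose 2"
    by (simp add: sum_lessThan_eq_choose_two)
  moreover have "finite I"
    by (simp add: I_def)
  moreover have "almost_cover (h ` I) permutohedron_vertices v"
    unfolding almost_cover_def
  proof (intro conjI ballI subsetI)
    fix H assume "H \<in> h ` I"
    then obtain i j where "H = {x. axis i 1 \<bullet> x = real j}"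
      by (auto simp: h_def inner_axis')
    moreover have "axis i 1 \<noteq> (0 :: real^'n)"
      by (simp add: axis_eq_0_iff)
    ultimately show "affine_hyperplane H"
      unfolding affine_hyperplane_def by blast
  next
    show "v \<in> permutohedron_vertices"
      using q by (auto simp: v_def permutohedron_vertices_def)
  next
    fix x :: "real^'n" assume "x \<in> permutohedron_vertices - {v}"
    then obtain p where p: "bij_betw p (UNIV :: 'n set) {1..CARD('n)}"
      and x: "x = (\<chi> i. real (p i))" "x \<noteq> v"
      by (auto simp: permutohedron_vertices_def)
    \<comment> \<open>Otherwise \<open>q \<le> p\<close> pointwise, which would give
      \<open>p = q\<close> and \<open>x = v\<close>.\<close>
    then obtain i where "p i < q i"
      using bij_betw_eq_of_le[OF finite p q] by (fastforce simp: v_def not_less[symmetric])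
    moreover have "1 \<le> p i"
      using bij_betwE[OF p] by auto
    ultimately show "x \<in> \<Union> (h ` I)"
      by (auto simp: h_def I_def x)
  next
    show "v \<notin> \<Union> (h ` I)"
      by (auto simp: h_def I_def v_def)
  qed
  ultimately show ?thesis
    by (metis finite_imageI card_image[OF inj])
qed

theorem theorem1:
  shows "(\<forall>(m :: nat) (H :: nat \<Rightarrow> (real ^ 'n) set) v.
            almost_cover (H ` {1..m}) permutohedron_vertices v \<longrightarrow> m \<ge> CARD('n) choose 2) \<and>
         (\<exists>(\<H> :: (real ^ 'n) set set) v. finite \<H> \<and> card \<H> = CARD('n) choose 2 \<and>
            almost_cover \<H> permutohedron_vertices v)"
  using almost_cover_permutohedron_ge[of "{1..m}" for m] permutohedron_almost_cover_exists
  by fastforce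

end
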